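(* Let $\mathcal{G}=\{G_n\}_{n\ge 0}$ be a sequence of filled graphs, where $G_n$ has vertex set $[n]$, and let $\mathbf{\Theta}=\{\Theta_n\}_{n\ge 0}$ be the associated sequence of lattice congruences of the weak order ($\Theta_n$ is the congruence on $\mathfrak{S}_n$ whose classes are the fibers of $\Psi_{G_n}$). (1) The family $\mathcal{G}$ is admissible if and only if $\mathbf{\Theta}$ is translational. (2) The family $\mathcal{G}$ is restriction-compatible if and only if $\mathbf{\Theta}$ is insertional.
   Context: Write $[n]=\{1,\dots,n\}$. Graphs are simple; $G|_I$ is the induced subgraph on $I$. A tube is a nonempty vertex set inducing a connected subgraph. $G$ on $[n]$ is filled if whenever $\{i,k\}$ is an edge and $i<j<k$, both $\{i,j\}$ and $\{j,k\}$ are edges. For a permutation $w=w_1\cdots w_n\in\mathfrak{S}_n$, $\Psi_G(w)=\{X_1,\dots,X_n\}$, where $X_j$ is the vertex set of the connected component of $G|_{\{w_1,\dots,w_j\}}$ containing $w_j$. The weak order on $\mathfrak{S}_n$: $x\le y$ iff every inversion of $x$ is an inversion of $y$, where $(i,k)$, $i<k$, is an inversion of $x$ if $k$ precedes $i$ in $x_1\cdots x_n$. A lattice congruence is an equivalence relation compatible with meets and joins. It is known that when $G$ is filled the equivalence relation on $\mathfrak{S}_n$ whose classes are the fibers of $\Psi_G$ is a lattice congruence of the weak order. Admissible: $\mathcal{G}=\{G_n\}_{n\ge0}$ is admissible if for all $n,m\ge0$, $G_{n+m}|_{[n]}=G_n$ and $G_{n+m}|_{\{n+1,\dots,n+m\}}$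 is the graph $G_m+n$ obtained from $G_m$ by adding $n$ to every vertex label. (This says that the operation $G_n\circ G_m=G_{n+m}$ is admissible.) Restriction-compatible: For a graph $H$ with vertex set a finite subset of $\mathbb{N}$, $\mathrm{std}(H)$ is the graph on $\{1,\dots,|V(H)|\}$ obtained by relabeling vertices by the order-preserving bijection. For $I\subseteq V(G)$, the contraction $G/I$ is the graph with vertex set $V(G)\setminus I$ in which $\{i,j\}$, $i\ne j$, is an edge if either $\{i,j\}\in E(G)$ or there is a tube $J$ of $G|_I$ and $k,l\in J$ with $\{i,k\},\{j,l\}\in E(G)$. $\mathcal{G}$ is restriction-compatible if for all $n$ and all $I\subseteq[n]$, $\mathrm{std}(G_n|_I)$ is a subgraph of $G_{|I|}$ and $\mathrm{std}(G_n/I)$ is a subgraph of $G_{n-|I|}$. Arcs: an arc on $[n]$ is a triple $(i,j,\epsilon)$ with $1\le i<j\le n$ and $\epsilon=(\epsilon_1,\dots,\epsilon_{j-i-1})\in\{+,-\}^{j-i-1}$. If $x\lessdot y$ is a cover relation in the weak order on $\mathfrak{S}_n$ in which $i<k$ are swapped, then $\alpha(x,y)=(i,k,\epsilon)$ where for $i<j<k$, $\epsilon_{j-i}=+$ if $j$ appears after $i$ and $k$ in $x$, and $\epsilon_{j-i}=-$ if $j$ appears before $i$ and $k$ in $x$. A lattice congruence $\Theta$ of the weak order contracts the arc $\alpha$ if there is a cover relation $x\lessdot y$ with $\alpha(x,y)=\alpha$ and $x\equiv y \bmod\Theta$ (equivalently, this holds for all covers with $\alpha(x,y)=\alpha$).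 Translational: an arc $(i,j,\epsilon)$ on $[n]$ is a translate of an arc $(k,l,\epsilon')$ on $[m]$ if $j-i=l-k$ and $\epsilon=\epsilon'$. $\{\Theta_n\}$ is translational if whenever $\Theta_n$ contracts $\alpha$ and an arc $\beta$ on $[m]$ is a translate of $\alpha$, then $\Theta_m$ contracts $\beta$ (for all $n,m$). Insertional: for an arc $\alpha=(i,j,\epsilon)$ on $[n]$ and $k\in[n]$, the deletion $\alpha\setminus k$ is the arc on $[n-1]$ given by $(i-1,j-1,\epsilon)$ if $k<i$; $(i,j,\epsilon)$ if $k>j$; and $(i,j-1,\epsilon')$ if $i\le k\le j$, where $\epsilon'_l=\epsilon_l$ for $l\le k-i$ and $\epsilon'_l=\epsilon_{l+1}$ for $l>k-i$ (so $\epsilon'$ is $\epsilon$ with one entry deleted; the deletion is undefined if $j=i+1$ and $k\in\{i,j\}$). An arc $\beta$ is obtained from $\alpha$ by inserting $k$ if $\alpha=\beta\setminus k$. $\{\Theta_n\}$ is insertional if for every $n$ and every arc $\alpha$ on $[n]$ contracted by $\Theta_n$, every arc $\beta$ on $[n+1]$ obtained from $\alpha$ by inserting some $k\in[n+1]$ is contracted by $\Theta_{n+1}$. *)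

theory Defs
  imports Main "HOL-Combinatorics.Multiset_Permutations" "HOL-Combinatorics.Transposition"
begin

section \<open>Simple graphs on natural numbers\<close>

record graph =
  verts :: "nat set"
  edges :: "nat set set"

definition simple_graph :: "graph \<Rightarrow> bool" where
  "simple_graph G \<longleftrightarrow> finite (verts G) \<and>
     edges G \<subseteq> {{u, v} | u v. u \<in> verts G \<and> v \<in> verts G \<and> u \<noteq> v}"

definition subgraph :: "graph \<Rightarrow> graph \<Rightarrow> bool" where
  "subgraph H G \<longleftrightarrow> verts H \<subseteq> verts G \<and> edges H \<subseteq> edges G"

definition induced :: "graph \<Rightarrow> nat set \<Rightarrow> graph" where
  "induced G I = \<lparr>verts = verts G \<inter> I, edges = {e \<in> edges G. e \<subseteq> I}\<rparr>"

definition reachable :: "graph \<Rightarrow> nat \<Rightarrow> nat \<Rightarrow> bool" where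
  "reachable G = (\<lambda>u v. {u, v} \<in> edges G)\<^sup>*\<^sup>*"

definition component :: "graph \<Rightarrow> nat \<Rightarrow> nat set" where
  "component G v = {u \<in> verts G. reachable G v u}"

definition connected_graph :: "graph \<Rightarrow> bool" where
  "connected_graph G \<longleftrightarrow> (\<forall>u \<in> verts G. \<forall>v \<in> verts G. reachable G u v)"

definition tube :: "graph \<Rightarrow> nat set \<Rightarrow> bool" where
  "tube G J \<longleftrightarrow> J \<noteq> {} \<and> J \<subseteq> verts G \<and> connected_graph (induced G J)"

definition filled :: "graph \<Rightarrow> bool" where
  "filled G \<longleftrightarrow> (\<forall>i j k. {i, k} \<in> edges G \<and> i < j \<and> j < k \<longrightarrow>
     {i, j} \<in> edges G \<and> {j, k} \<in> edges G)"

definition relabel :: "(nat \<Rightarrow> nat) \<Rightarrow> graph \<Rightarrow> graph" where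
  "relabel f G = \<lparr>verts = f ` verts G, edges = (\<lambda>e. f ` e) ` edges G\<rparr>"

definition rank :: "nat set \<Rightarrow> nat \<Rightarrow> nat" where
  "rank V v = card {u \<in> V. u \<le> v}"

definition std :: "graph \<Rightarrow> graph" where
  "std H = relabel (rank (verts H)) H"

text \<open>The map \<open>rank V\<close> is the order-preserving bijection from \<open>V\<close> to \<open>{1..card V}\<close>.\<close>

lemma rank_strict_mono_on:
  assumes "finite V"
  shows "strict_mono_on V (rank V)"
proof (rule strict_mono_onI)
  fix u v assume "u \<in> V" "v \<in> V" "u < v"
  then have "{a \<in> V. a \<le> u} \<subset> {a \<in> V. a \<le> v}" by force
  then show "rank V u < rank V v"
    unfolding rank_def using assms by (intro psubset_card_mono) auto
qed

lemma rank_bij_betw: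
  assumes "finite V"
  shows "bij_betw (rank V) V {1..card V}"
proof -
  have inj: "inj_on (rank V) V"
    using rank_strict_mono_on[OF assms] by (rule strict_mono_on_imp_inj_on)
  have "rank V v \<in> {1..card V}" if "v \<in> V" for v
  proof -
    have "{u \<in> V. u \<le> v} \<noteq> {}" using that by auto
    then have "0 < rank V v" unfolding rank_def using assms by (simp add: card_gt_0_iff)
    moreover have "rank V v \<le> card V" unfolding rank_def using assms by (intro card_mono) auto
    ultimately show ?thesis by simp
  qed
  then have "rank V ` V \<subseteq> {1..card V}" by auto
  then have "rank V ` V = {1..card V}"
    using card_image[OF inj] by (intro card_subset_eq) auto
  with inj show ?thesis by (simp add: bij_betw_def)
qed

definition contraction :: "graph \<Rightarrow> nat set \<Rightarrow> graph" where
  "contraction G I = \<lparr>verts = verts G - I,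
     edges = {{i, j} | i j. i \<in> verts G - I \<and> j \<in> verts G - I \<and> i \<noteq> j \<and>
       ({i, j} \<in> edges G \<or>
        (\<exists>J k l. tube (induced G I) J \<and> k \<in> J \<and> l \<in> J \<and> {i, k} \<in> edges G \<and> {j, l} \<in> edges G))}\<rparr>"

definition admissible :: "(nat \<Rightarrow> graph) \<Rightarrow> bool" where
  "admissible \<G> \<longleftrightarrow> (\<forall>n m.
     induced (\<G> (n + m)) {1..n} = \<G> n \<and>
     induced (\<G> (n + m)) {n + 1..n + m} = relabel (\<lambda>v. v + n) (\<G> m))"

definition restriction_compatible :: "(nat \<Rightarrow> graph) \<Rightarrow> bool" where
  "restriction_compatible \<G> \<longleftrightarrow> (\<forall>n. \<forall>I \<subseteq> {1..n}.
     subgraph (std (induced (\<G> n) I)) (\<G> (card I)) \<and>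
     subgraph (std (contraction (\<G> n) I)) (\<G> (n - card I)))"

section \<open>Permutations and the weak order\<close>

text \<open>Permutations are lists in one-line notation; list positions count from 0.\<close>

abbreviation perms :: "nat \<Rightarrow> nat list set" where
  "perms n \<equiv> permutations_of_set {1..n}"

definition precedes :: "nat list \<Rightarrow> nat \<Rightarrow> nat \<Rightarrow> bool" where
  "precedes x a b \<longleftrightarrow> (\<exists>p q. p < q \<and> q < length x \<and> x ! p = a \<and> x ! q = b)"

definition inversions :: "nat list \<Rightarrow> (nat \<times> nat) set" where
  "inversions x = {(i, k). i < k \<and> precedes x k i}"

definition weak_le :: "nat list \<Rightarrow> nat list \<Rightarrow> bool" where
  "weak_le x y \<longleftrightarrow> inversions x \<subseteq> inversions y"

definition weak_cover :: "nat \<Rightarrow> nat list \<Rightarrow> nat list \<Rightarrow> bool" where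
  "weak_cover n x y \<longleftrightarrow> x \<in> perms n \<and> y \<in> perms n \<and> weak_le x y \<and> x \<noteq> y \<and>
     (\<forall>z \<in> perms n. weak_le x z \<and> weak_le z y \<longrightarrow> z = x \<or> z = y)"

definition Psi :: "graph \<Rightarrow> nat list \<Rightarrow> nat set set" where
  "Psi G w = {component (induced G (set (take (Suc p) w))) (w ! p) | p. p < length w}"

definition fiber_congruence :: "nat \<Rightarrow> graph \<Rightarrow> (nat list \<times> nat list) set" where
  "fiber_congruence n G = {(x, y). x \<in> perms n \<and> y \<in> perms n \<and> Psi G x = Psi G y}"

section \<open>Arcs\<close>

datatype sign = Plus | Minus

type_synonym arc = "nat \<times> nat \<times> sign list"

definition arcs :: "nat \<Rightarrow> arc set" where
  "arcs n = {(i, j, \<epsilon>). 1 \<le> i \<and> i < j \<and> j \<le> n \<and> length \<epsilon> = j - i - 1}"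

text \<open>
  \<open>cover_arc n x y \<alpha>\<close>: \<open>x\<close> is covered by \<open>y\<close> in the weak order and \<open>\<alpha>(x, y) = \<alpha>\<close>.
  The list \<open>\<epsilon>\<close> counts from 0, so the sign attached to \<open>j\<close> (the \<open>(j - i)\<close>-th one) is
  \<open>\<epsilon> ! (j - i - 1)\<close>.
\<close>

definition cover_arc :: "nat \<Rightarrow> nat list \<Rightarrow> nat list \<Rightarrow> arc \<Rightarrow> bool" where
  "cover_arc n x y \<alpha> \<longleftrightarrow> weak_cover n x y \<and> \<alpha> \<in> arcs n \<and>
     (case \<alpha> of (i, k, \<epsilon>) \<Rightarrow>
        y = map (transpose i k) x \<and>
        (\<forall>j. i < j \<and> j < k \<longrightarrow>
           (\<epsilon> ! (j - i - 1) = Plus \<and> precedes x i j \<and> precedes x k j) \<or>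
           (\<epsilon> ! (j - i - 1) = Minus \<and> precedes x j i \<and> precedes x j k)))"

text \<open>
  The notions below are meant for lattice congruences of the weak order, but make sense for
  any relation on permutations. That \<open>fiber_congruence n G\<close> is a lattice congruence whenever
  \<open>G\<close> is filled is a known fact, not built into the definitions.
\<close>

definition contracts :: "nat \<Rightarrow> (nat list \<times> nat list) set \<Rightarrow> arc \<Rightarrow> bool" where
  "contracts n \<Theta> \<alpha> \<longleftrightarrow> (\<exists>x y. cover_arc n x y \<alpha> \<and> (x, y) \<in> \<Theta>)"

definition translate :: "arc \<Rightarrow> arc \<Rightarrow> bool" where
  "translate \<beta> \<alpha> \<longleftrightarrow>
     (case \<beta> of (i, j, \<epsilon>) \<Rightarrow> case \<alpha> of (k, l, \<epsilon>') \<Rightarrow> j - i = l - k \<and> \<epsilon> = \<epsilon>')"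

definition translational :: "(nat \<Rightarrow> (nat list \<times> nat list) set) \<Rightarrow> bool" where
  "translational \<Theta> \<longleftrightarrow> (\<forall>n m. \<forall>\<alpha> \<in> arcs n. \<forall>\<beta> \<in> arcs m.
     contracts n (\<Theta> n) \<alpha> \<and> translate \<beta> \<alpha> \<longrightarrow> contracts m (\<Theta> m) \<beta>)"

text \<open>
  \<open>arc_delete \<alpha> k\<close> is \<open>\<alpha> \ k\<close>, or \<open>None\<close> where that is undefined. The index \<open>l\<close> counts
  from 1, so the \<open>l\<close>-th and \<open>(l + 1)\<close>-th signs are \<open>\<epsilon> ! (l - 1)\<close> and \<open>\<epsilon> ! l\<close>.
\<close>

fun arc_delete :: "arc \<Rightarrow> nat \<Rightarrow> arc option" where
  "arc_delete (i, j, \<epsilon>) k =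
     (if k < i then Some (i - 1, j - 1, \<epsilon>)
      else if j < k then Some (i, j, \<epsilon>)
      else if j = i + 1 then None
      else Some (i, j - 1, map (\<lambda>l. if l \<le> k - i then \<epsilon> ! (l - 1) else \<epsilon> ! l) [1..<j - i - 1]))"

definition insertional :: "(nat \<Rightarrow> (nat list \<times> nat list) set) \<Rightarrow> bool" where
  "insertional \<Theta> \<longleftrightarrow> (\<forall>n. \<forall>\<alpha> \<in> arcs n. contracts n (\<Theta> n) \<alpha> \<longrightarrow>
     (\<forall>\<beta> \<in> arcs (n + 1). \<forall>k \<in> {1..n + 1}.
        arc_delete \<beta> k = Some \<alpha> \<longrightarrow> contracts (n + 1) (\<Theta> (n + 1)) \<beta>))"

end

theory Submission imports Defs begin

text \<open>
  For \<open>i < k\<close>, swapping the adjacent entries \<open>i\<close> and \<open>k\<close> in a permutation leaves its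
  tubing unchanged iff \<open>i\<close> and \<open>k\<close> lie in different components of the subgraph induced on
  \<open>i\<close>, \<open>k\<close> and the entries before them. In a filled graph this depends only on the entries strictly
  between \<open>i\<close> and \<open>k\<close> in value: the two are connected iff any two vertices of \<open>{i..k}\<close> that are not
  separated by an earlier entry are adjacent. Hence an arc is contracted iff such a pair with only
  plus signs strictly in between is not adjacent. All-plus arcs detect single edges, which turns
  translationality into invariance of edges under shifts.

  For the second part, removing the sign of a vertex \<open>k\<close> and contracting \<open>{k}\<close> are governed by the same
  one-vertex condition on consecutive graphs of the family. It implies restriction-compatibility by
  induction on the contracted set; restrictions come for free, since the graph induced on \<open>I\<close> is a
  subgraph of the contraction of the complement of \<open>I\<close>.
\<close>

section \<open>Connectivity in filled graphs\<close>

text \<open>For filled \<open>G\<close> and \<open>a < b\<close> this says that \<open>a\<close> and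
  \<open>b\<close> are connected in the graph induced on \<open>a\<close>, \<open>b\<close> and
  \<open>S\<close> (\<open>reachable_iff_linked\<close>). The pairs \<open>u\<close>,
  \<open>v\<close> range over the whole interval and need not lie in \<open>S\<close>; this makes
  the condition easy to restrict to subintervals, to shift and to transport when a vertex is
  removed.\<close>

definition linked :: "graph \<Rightarrow> nat set \<Rightarrow> nat \<Rightarrow> nat \<Rightarrow> bool" where
  "linked G S a b \<longleftrightarrow>
     (\<forall>u v. a \<le> u \<and> u < v \<and> v \<le> b \<and> {u<..<v} \<inter> S = {} \<longrightarrow> {u, v} \<in> edges G)"

lemma linkedD:
  "linked G S a b \<Longrightarrow> a \<le> u \<Longrightarrow> u < v \<Longrightarrow> v \<le> b \<Longrightarrow> {u<..<v} \<inter> S = {} \<Longrightarrow> {u, v} \<in> edges G"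
  unfolding linked_def by blast

lemma linked_subinterval: "linked G S a b \<Longrightarrow> a \<le> u \<Longrightarrow> v \<le> b \<Longrightarrow> linked G S u v"
  unfolding linked_def by (meson le_trans)

lemma linked_cong:
  assumes "S \<inter> {a<..<b} = T \<inter> {a<..<b}"
  shows "linked G S a b \<longleftrightarrow> linked G T a b"
proof -
  have "a \<le> u \<and> u < v \<and> v \<le> b \<and> {u<..<v} \<inter> S = {} \<longleftrightarrow>
      a \<le> u \<and> u < v \<and> v \<le> b \<and> {u<..<v} \<inter> T = {}" for u v
  proof (cases "a \<le> u \<and> v \<le> b")
    case True
    then have "{u<..<v} \<inter> S = {u<..<v} \<inter> ({a<..<b} \<inter> S)" "{u<..<v} \<inter> T = {u<..<v} \<inter> ({a<..<b} \<inter> T)"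
      by auto
    then show ?thesis using assms by (simp add: Int_commute)
  qed auto
  then show ?thesis unfolding linked_def by simp
qed

text \<open>Filledness is applied twice: first the left end moves from \<open>p\<close> to
  \<open>u\<close>, then the right end from \<open>q\<close> to \<open>v\<close>.\<close>

lemma filled_edge_mono:
  assumes "filled G" "{p, q} \<in> edges G" "p \<le> u" "u < v" "v \<le> q"
  shows "{u, v} \<in> edges G"
proof -
  have filledD: "{i, j} \<in> edges G \<and> {j, k} \<in> edges G" if "{i, k} \<in> edges G" "i < j" "j < k" for i j k
    using assms(1) that unfolding filled_def by blast
  have "{u, q} \<in> edges G"
    using assms filledD[of p q u] by (cases "p = u") auto
  then show ?thesis
    using assms filledD[of u q v] by (cases "v = q") auto
qed

lemma linked_if_edge: "filled G \<Longrightarrow> {a, b} \<in> edges G \<Longrightarrow> linked G S a b"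
  unfolding linked_def using filled_edge_mono by metis

text \<open>A pair in \<open>{a..b}\<close> that \<open>k\<close> does not separate lies entirely on
  one side of \<open>k\<close>, hence inside one of the edges \<open>{a, k}\<close> and
  \<open>{k, b}\<close>. This is the form in which \<open>linked\<close> is compared with the edges
  of a contraction by \<open>{k}\<close>.\<close>

lemma linked_singleton_iff:
  assumes "filled G" "a < b" "k \<noteq> a" "k \<noteq> b"
  shows "linked G {k} a b \<longleftrightarrow>
    (if a < k \<and> k < b then {a, k} \<in> edges G \<and> {k, b} \<in> edges G else {a, b} \<in> edges G)"
proof (cases "a < k \<and> k < b")
  case True
  have "linked G {k} a b" if "{a, k} \<in> edges G" "{k, b} \<in> edges G"
    unfolding linked_def
  proof (intro allI impI)
    fix u v assume uv: "a \<le> u \<and> u < v \<and> v \<le> b \<and> {u<..<v} \<inter> {k} = {}"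
    then have "v \<le> k \<or> k \<le> u" by auto
    then show "{u, v} \<in> edges G"
      using uv filled_edge_mono[OF assms(1) that(1)] filled_edge_mono[OF assms(1) that(2)] by blast
  qed
  moreover have "{a, k} \<in> edges G \<and> {k, b} \<in> edges G" if "linked G {k} a b"
    using True by (auto intro: linkedD[OF that])
  ultimately show ?thesis using True by auto
next
  case False
  then have "{a, b} \<in> edges G" if "linked G {k} a b"
    using assms by (intro linkedD[OF that]) auto
  with False show ?thesis using linked_if_edge[OF assms(1)] by auto
qed

section \<open>Walks in induced subgraphs\<close>

lemma edges_induced: "{u, v} \<in> edges (induced G S) \<longleftrightarrow> {u, v} \<in> edges G \<and> u \<in> S \<and> v \<in> S"
  by (auto simp: induced_def)

lemma reachable_refl [simp]: "reachable G u u"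
  by (simp add: reachable_def)

lemma reachable_trans: "reachable G u v \<Longrightarrow> reachable G v w \<Longrightarrow> reachable G u w"
  unfolding reachable_def by (rule rtranclp_trans)

lemma reachable_edge: "{u, v} \<in> edges G \<Longrightarrow> reachable G u v"
  unfolding reachable_def by (rule r_into_rtranclp)

lemma reachable_sym: "reachable G u v \<Longrightarrow> reachable G v u"
  unfolding reachable_def
proof (induction rule: rtranclp_induct)
  case (step y z)
  then have "{z, y} \<in> edges G" by (simp add: insert_commute)
  with step.IH show ?case by (rule converse_rtranclp_into_rtranclp[rotated])
qed simp

lemma reachable_mono:
  assumes "reachable G u v" "edges G \<subseteq> edges H"
  shows "reachable H u v"
  using assms(1) unfolding reachable_def
  by (rule rtranclp_mono[THEN predicate2D, rotated]) (use assms(2) in auto)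

lemma reachable_induced_mono:
  assumes "reachable (induced G S) u v" "S \<subseteq> T"
  shows "reachable (induced G T) u v"
  using assms(1) by (rule reachable_mono) (use assms(2) in \<open>auto simp: induced_def\<close>)

text \<open>A discrete intermediate value argument: a walk that starts at or below \<open>u\<close>
  and ends above it must use an edge crossing from one side to the other.\<close>

lemma reachable_crossing_edge:
  assumes "reachable G a b" "a \<le> u" "u < b"
  obtains p q where "{p, q} \<in> edges G" "p \<le> u" "u < q"
proof -
  have "b \<le> u \<or> (\<exists>p q. {p, q} \<in> edges G \<and> p \<le> u \<and> u < q)"
    using assms(1) unfolding reachable_def
  proof (induction rule: rtranclp_induct)
    case (step y z)
    show ?case
    proof (cases "y \<le> u \<and> u < z")
      case True
      with step.hyps(2) show ?thesis by blast
    next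
      case False
      with step.IH show ?thesis by auto
    qed
  qed (use assms(2) in simp)
  with assms(3) that show ?thesis by auto
qed

text \<open>Strong induction on \<open>b - a\<close>. If no element of \<open>S\<close> lies
  strictly between, \<open>a\<close> and \<open>b\<close> themselves form an unseparated pair and
  are adjacent; otherwise such an element splits the walk into two shorter ones.\<close>

lemma linked_imp_reachable:
  assumes "linked G S a b" "a < b"
  shows "reachable (induced G (insert a (insert b S))) a b"
  using assms
proof (induction "b - a" arbitrary: a b rule: less_induct)
  case less
  show ?case
  proof (cases "{a<..<b} \<inter> S = {}")
    case True
    then have "{a, b} \<in> edges G" using less.prems by (intro linkedD[OF less.prems(1)]) auto
    then show ?thesis by (intro reachable_edge) (simp add: edges_induced)
  next
    case False
    then obtain w where w: "a < w" "w < b" "w \<in> S" by auto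
    have "reachable (induced G (insert a (insert w S))) a w"
      using w less.prems(2) by (intro less.hyps linked_subinterval[OF less.prems(1)]) auto
    moreover have "reachable (induced G (insert w (insert b S))) w b"
      using w less.prems(2) by (intro less.hyps linked_subinterval[OF less.prems(1)]) auto
    ultimately show ?thesis
      using w(3) reachable_induced_mono[where T = "insert a (insert b S)"]
      by (intro reachable_trans[of _ a w b]) auto
  qed
qed

text \<open>The walk has an edge \<open>{p, q}\<close> with \<open>p \<le> u < q\<close>. Its upper
  end is \<open>b\<close> or lies in \<open>S\<close>, so it cannot fall strictly between
  \<open>u\<close> and \<open>v\<close>, and filledness shrinks \<open>{p, q}\<close> to
  \<open>{u, v}\<close>.\<close>

lemma reachable_imp_linked:
  assumes "filled G" "reachable (induced G (insert a (insert b S))) a b"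
  shows "linked G S a b"
  unfolding linked_def
proof (intro allI impI)
  fix u v assume uv: "a \<le> u \<and> u < v \<and> v \<le> b \<and> {u<..<v} \<inter> S = {}"
  then obtain p q where pq: "{p, q} \<in> edges (induced G (insert a (insert b S)))" "p \<le> u" "u < q"
    using reachable_crossing_edge[OF assms(2)] by (metis less_le_trans)
  then have "q = b \<or> q \<in> S" "{p, q} \<in> edges G"
    using uv by (auto simp: edges_induced)
  moreover from this have "v \<le> q"
    using uv pq(3) by (meson disjoint_iff greaterThanLessThan_iff not_le)
  ultimately show "{u, v} \<in> edges G"
    using uv pq(2) assms(1) by (blast intro: filled_edge_mono)
qed

lemma reachable_iff_linked:
  assumes "filled G" "a < b"
  shows "reachable (induced G (insert a (insert b S))) a b \<longleftrightarrow> linked G S a b"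
  using assms linked_imp_reachable reachable_imp_linked by blast

section \<open>Covers and the fibers of the map to tubings\<close>

lemma precedes_Nil [simp]: "\<not> precedes [] a b"
  by (simp add: precedes_def)

lemma precedes_Cons [simp]:
  "precedes (x # xs) a b \<longleftrightarrow> x = a \<and> b \<in> set xs \<or> precedes xs a b" (is "?L \<longleftrightarrow> ?R")
proof
  assume ?L
  then obtain p q where pq: "p < q" "q < Suc (length xs)" "(x # xs) ! p = a" "(x # xs) ! q = b"
    unfolding precedes_def by auto
  then obtain q' where q: "q = Suc q'" by (cases q) auto
  show ?R
  proof (cases p)
    case 0
    then show ?thesis using pq q by auto
  next
    case (Suc p')
    then have "p' < q' \<and> q' < length xs \<and> xs ! p' = a \<and> xs ! q' = b" using pq q by simp
    then show ?thesis unfolding precedes_def by blast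
  qed
next
  assume ?R
  then show ?L
  proof (elim disjE conjE)
    assume "x = a" "b \<in> set xs"
    then obtain q where "q < length xs" "xs ! q = b" by (auto simp: in_set_conv_nth)
    with \<open>x = a\<close> show ?L unfolding precedes_def by (intro exI[of _ 0] exI[of _ "Suc q"]) simp
  next
    assume "precedes xs a b"
    then obtain p q where "p < q" "q < length xs" "xs ! p = a" "xs ! q = b"
      unfolding precedes_def by blast
    then show ?L unfolding precedes_def by (intro exI[of _ "Suc p"] exI[of _ "Suc q"]) simp
  qed
qed

lemma precedes_append:
  "precedes (xs @ ys) a b \<longleftrightarrow>
     precedes xs a b \<or> precedes ys a b \<or> a \<in> set xs \<and> b \<in> set ys"
  by (induction xs) auto

lemma precedes_in_set: "precedes xs a b \<Longrightarrow> a \<in> set xs \<and> b \<in> set xs"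
  by (induction xs) auto

lemma precedes_total:
  "a \<in> set xs \<Longrightarrow> b \<in> set xs \<Longrightarrow> a \<noteq> b \<Longrightarrow> precedes xs a b \<or> precedes xs b a"
  by (induction xs) auto

lemma precedes_asym: "distinct xs \<Longrightarrow> precedes xs a b \<Longrightarrow> \<not> precedes xs b a"
  by (induction xs) (auto dest: precedes_in_set)

text \<open>The heads must agree: otherwise \<open>x\<close> precedes \<open>y\<close> in the first
  list, whereas nothing precedes the head \<open>y\<close> in the second. The tails then agree by
  induction.\<close>

lemma precedes_inject:
  assumes "distinct xs" "distinct ys" "set xs = set ys"
    and "\<And>a b. a \<noteq> b \<Longrightarrow> precedes xs a b \<longleftrightarrow> precedes ys a b"
  shows "xs = ys"
  using assms
proof (induction xs arbitrary: ys)
  case Nil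
  then show ?case by simp
next
  case (Cons x xs)
  then obtain y ys' where ys: "ys = y # ys'" by (cases ys) auto
  have "x = y"
  proof (rule ccontr)
    assume "x \<noteq> y"
    moreover from this have "precedes (x # xs) x y" using Cons.prems(3) ys by auto
    ultimately have "precedes ys x y" using Cons.prems(4) by blast
    with \<open>x \<noteq> y\<close> show False using Cons.prems(2) ys by (auto dest: precedes_in_set)
  qed
  moreover have "xs = ys'"
  proof (rule Cons.IH)
    show "set xs = set ys'"
      using Cons.prems(1-3) ys \<open>x = y\<close> by (simp add: insert_ident)
    fix a b :: nat assume "a \<noteq> b"
    then show "precedes xs a b \<longleftrightarrow> precedes ys' a b"
      using Cons.prems(1,2) Cons.prems(4)[of a b] ys \<open>x = y\<close> by (auto dest: precedes_in_set)
  qed (use Cons.prems ys in auto)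
  ultimately show ?case using ys by simp
qed

section \<open>Inversions and covers in the weak order\<close>

lemma inversions_inject:
  assumes "x \<in> perms n" "y \<in> perms n" "inversions x = inversions y"
  shows "x = y"
proof (rule precedes_inject)
  have xy: "distinct x" "distinct y" "set x = {1..n}" "set y = {1..n}"
    using assms by (auto simp: permutations_of_set_def)
  then show "distinct x" "distinct y" "set x = set y" by auto
  have inv: "precedes x k i \<longleftrightarrow> precedes y k i" if "i < k" for i k
    using assms(3) that by (auto simp: inversions_def set_eq_iff)
  fix a b :: nat assume "a \<noteq> b"
  then consider "b < a" | "a < b" by linarith
  then show "precedes x a b \<longleftrightarrow> precedes y a b"
  proof cases
    case 1
    then show ?thesis by (rule inv)
  next
    case 2
    \<comment> \<open>Inversions record only pairs whose larger entry comes first; for distinct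
      entries the other order is the negation.\<close>
    have "precedes z a b \<longleftrightarrow> a \<in> {1..n} \<and> b \<in> {1..n} \<and> \<not> precedes z b a"
      if "distinct z" "set z = {1..n}" for z
      using that \<open>a \<noteq> b\<close> precedes_total[of a z b] precedes_asym[of z a b] precedes_in_set[of z a b]
      by blast
    then show ?thesis using xy inv[OF 2] by blast
  qed
qed

lemma inversions_adjacent_swap:
  "i < k \<Longrightarrow> inversions (A @ k # i # B) = insert (i, k) (inversions (A @ i # k # B))"
  by (auto simp: inversions_def precedes_append)

text \<open>The two inversion sets differ in a single pair, so any inversion set between them equals
  one of them, and inversion sets determine permutations.\<close>

lemma adjacent_swap_weak_cover:
  assumes "A @ i # k # B \<in> perms n" "i < k"
  shows "weak_cover n (A @ i # k # B) (A @ k # i # B)"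
proof -
  let ?x = "A @ i # k # B" and ?y = "A @ k # i # B"
  have y: "?y \<in> perms n"
    using assms(1) by (auto simp: permutations_of_set_def)
  have "z = ?x \<or> z = ?y" if "z \<in> perms n" "weak_le ?x z" "weak_le z ?y" for z
  proof -
    have "inversions z = inversions ?x \<or> inversions z = inversions ?y"
      using that(2,3) unfolding weak_le_def inversions_adjacent_swap[OF assms(2)] by blast
    then show ?thesis using inversions_inject that(1) assms(1) y by blast
  qed
  then show ?thesis
    unfolding weak_cover_def weak_le_def inversions_adjacent_swap[OF assms(2)]
    using assms y inversions_adjacent_swap[OF assms(2)] by (auto simp: weak_le_def)
qed

lemma precedes_map: "precedes xs a b \<Longrightarrow> precedes (map f xs) (f a) (f b)"
  by (induction xs) auto

section \<open>Arcs and the covers that carry them\<close>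

definition minus_set :: "arc \<Rightarrow> nat set" where
  "minus_set = (\<lambda>(i, j, \<epsilon>). {v \<in> {i<..<j}. \<epsilon> ! (v - i - 1) = Minus})"

text \<open>The definition of \<open>cover_arc\<close> does not say that \<open>i\<close> and
  \<open>k\<close> are adjacent in \<open>x\<close>. An entry \<open>v\<close> placed between them
  would lose an inversion under the swap if \<open>v < i\<close> or \<open>k < v\<close>,
  contradicting \<open>weak_le\<close>, and would contradict the sign condition if
  \<open>i < v < k\<close>. The prefix \<open>A\<close> then holds exactly those intermediate values
  that carry a minus sign.\<close>

lemma cover_arcE:
  assumes "cover_arc n x y (i, k, \<epsilon>)"
  obtains A B where "x = A @ i # k # B" "y = A @ k # i # B" "x \<in> perms n"
    "set A \<inter> {i<..<k} = minus_set (i, k, \<epsilon>)"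
proof -
  have xy: "x \<in> perms n" "y \<in> perms n" "inversions x \<subseteq> inversions y"
    and arc: "1 \<le> i" "i < k" "k \<le> n"
    and y: "y = map (transpose i k) x"
    and sides: "\<And>j. i < j \<Longrightarrow> j < k \<Longrightarrow>
      \<epsilon> ! (j - i - 1) = Plus \<and> precedes x i j \<and> precedes x k j \<or>
      \<epsilon> ! (j - i - 1) = Minus \<and> precedes x j i \<and> precedes x j k"
    using assms unfolding cover_arc_def weak_cover_def weak_le_def arcs_def by auto
  have x: "distinct x" "set x = {1..n}" and "distinct y"
    using xy by (auto simp: permutations_of_set_def)
  have "\<not> precedes x k i"
  proof
    assume ki: "precedes x k i"
    then have "precedes y k i" using xy(3) arc by (auto simp: inversions_def)
    moreover have "precedes y i k" using precedes_map[OF ki, of "transpose i k"] y by simp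
    ultimately show False using precedes_asym[OF \<open>distinct y\<close>] by blast
  qed
  then have ik: "precedes x i k" using precedes_total[of i x k] x arc by auto
  obtain A C where AC: "x = A @ i # C" using ik by (meson precedes_in_set split_list)
  then have "k \<in> set C" using ik x(1) by (auto simp: precedes_append dest: precedes_in_set)
  then obtain D B where "C = D @ k # B" by (meson split_list)
  with AC have xd: "x = A @ i # D @ k # B" by simp
  have "map (transpose i k) zs = zs" if "i \<notin> set zs" "k \<notin> set zs" for zs
    using that by (intro map_idI) (auto simp: transpose_def)
  then have yd: "y = A @ k # D @ i # B" using y xd x(1) by auto
  have "D = []"
  proof (rule ccontr)
    assume "D \<noteq> []"
    then obtain v where v: "v \<in> set D" by (cases D) auto
    then have "v \<noteq> i" "v \<noteq> k" using x(1) xd by auto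
    then consider "v < i" | "i < v" "v < k" | "k < v" by linarith
    then show False
    proof cases
      case 1
      then have "(v, i) \<in> inversions x" using v xd by (auto simp: inversions_def precedes_append)
      then have "precedes y i v" using xy(3) by (auto simp: inversions_def)
      moreover have "precedes y v i" using v yd by (auto simp: precedes_append)
      ultimately show False using precedes_asym[OF \<open>distinct y\<close>] by blast
    next
      case 2
      moreover have "precedes x i v" "precedes x v k" using v xd by (auto simp: precedes_append)
      ultimately show False using sides[of v] precedes_asym[OF x(1)] by blast
    next
      case 3
      then have "(k, v) \<in> inversions x" using v xd by (auto simp: inversions_def precedes_append)
      then have "precedes y v k" using xy(3) by (auto simp: inversions_def)
      moreover have "precedes y k v" using v yd by (auto simp: precedes_append)
      ultimately show False using precedes_asym[OF \<open>distinct y\<close>] by blast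
    qed
  qed
  then have xd': "x = A @ i # k # B" and yd': "y = A @ k # i # B" using xd yd by auto
  have "v \<in> set A \<longleftrightarrow> \<epsilon> ! (v - i - 1) = Minus" if v: "i < v" "v < k" for v
  proof -
    have "v \<in> set A \<longleftrightarrow> precedes x v i"
      using x(1) v xd' by (auto simp: precedes_append dest: precedes_in_set)
    then show ?thesis using sides[OF v] precedes_asym[OF x(1), of v i] by auto
  qed
  then have "set A \<inter> {i<..<k} = minus_set (i, k, \<epsilon>)"
    by (auto simp: minus_set_def)
  with xd' yd' xy(1) show ?thesis by (rule that)
qed

text \<open>The witness lists the vertices with a minus sign, then \<open>i\<close> and
  \<open>k\<close>, then everything else. Values outside \<open>{i..k}\<close> are not constrained
  by the arc and all go to the end.\<close>

lemma cover_arc_exists: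
  assumes "(i, k, \<epsilon>) \<in> arcs n"
  obtains A B where "cover_arc n (A @ i # k # B) (A @ k # i # B) (i, k, \<epsilon>)"
proof -
  define M where "M = minus_set (i, k, \<epsilon>)"
  define A where "A = sorted_list_of_set M"
  define B where "B = sorted_list_of_set ({1..n} - M - {i, k})"
  have arc: "1 \<le> i" "i < k" "k \<le> n" using assms by (auto simp: arcs_def)
  have M: "M \<subseteq> {i<..<k}" "finite M" by (auto simp: M_def minus_set_def)
  then have AB: "set A = M" "distinct A" "set B = {1..n} - M - {i, k}" "distinct B"
    by (auto simp: A_def B_def)
  let ?x = "A @ i # k # B"
  have "M \<subseteq> {1..n}" "i \<in> {1..n}" "k \<in> {1..n}" and ikM: "i \<notin> M" "k \<notin> M" "i \<noteq> k"
    using M arc by (force, auto)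
  then have "M \<union> insert i (insert k ({1..n} - M - {i, k})) = {1..n}" by blast
  then have "set ?x = {1..n}" by (simp only: set_append list.set AB)
  moreover have "distinct ?x"
    unfolding distinct_append distinct.simps list.set AB using AB(2,4) ikM by blast
  ultimately have x: "?x \<in> perms n" by (rule permutations_of_setI)
  have "map (transpose i k) zs = zs" if "i \<notin> set zs" "k \<notin> set zs" for zs
    using that by (intro map_idI) (auto simp: transpose_def)
  from this[of A] this[of B] have "A @ k # i # B = map (transpose i k) ?x" using AB ikM by simp
  moreover have "\<epsilon> ! (j - i - 1) = Plus \<and> precedes ?x i j \<and> precedes ?x k j \<or>
      \<epsilon> ! (j - i - 1) = Minus \<and> precedes ?x j i \<and> precedes ?x j k" if "i < j" "j < k" for j
  proof (cases "\<epsilon> ! (j - i - 1)")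
    case Plus
    then have "j \<in> set B" using AB arc that by (auto simp: M_def minus_set_def)
    with Plus show ?thesis by (auto simp: precedes_append)
  next
    case Minus
    then have "j \<in> set A" using AB arc that by (auto simp: M_def minus_set_def)
    with Minus show ?thesis by (auto simp: precedes_append)
  qed
  ultimately have "cover_arc n ?x (A @ k # i # B) (i, k, \<epsilon>)"
    unfolding cover_arc_def using assms adjacent_swap_weak_cover[OF x arc(2)] by auto
  then show ?thesis by (rule that)
qed

section \<open>Tubings computed along a list\<close>

fun tubes :: "graph \<Rightarrow> nat set \<Rightarrow> nat list \<Rightarrow> nat set set" where
  "tubes G S [] = {}"
| "tubes G S (v # vs) = insert (component (induced G (insert v S)) v) (tubes G (insert v S) vs)"

lemma tubes_eq:
  "tubes G S w = {component (induced G (S \<union> set (take (Suc p) w))) (w ! p) | p. p < length w}"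
proof (induction w arbitrary: S)
  case Nil
  then show ?case by simp
next
  case (Cons v w)
  have "{f p | p. p < Suc m} = insert (f 0) {f (Suc p) | p. p < m}" for f :: "nat \<Rightarrow> nat set" and m
    unfolding less_Suc_eq_0_disj by blast
  then show ?case by (simp add: Cons.IH)
qed

lemma Psi_eq_tubes: "Psi G w = tubes G {} w"
  by (simp add: Psi_def tubes_eq)

text \<open>The accumulator \<open>S\<close> of earlier entries exists for this splitting: a swap
  inside a permutation leaves the tubes contributed by the prefix and by the suffix
  unchanged.\<close>

lemma tubes_append: "tubes G S (xs @ ys) = tubes G S xs \<union> tubes G (set xs \<union> S) ys"
  by (induction xs arbitrary: S) auto

lemma component_subset: "component (induced G S) v \<subseteq> S"
  by (auto simp: component_def induced_def)

lemma tubes_subset: "X \<in> tubes G S w \<Longrightarrow> X \<subseteq> S \<union> set w"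
proof (induction w arbitrary: S)
  case (Cons v w)
  then show ?case
    using component_subset[of G "insert v S" v] by (cases "X \<in> tubes G (insert v S) w") fastforce+
qed simp

lemma tubes_meet: "X \<in> tubes G S w \<Longrightarrow> set w \<subseteq> verts G \<Longrightarrow> X \<inter> set w \<noteq> {}"
  by (induction w arbitrary: S) (auto simp: component_def induced_def)

text \<open>Every vertex on a walk from \<open>i\<close> is itself reachable from \<open>i\<close>,
  so the walk never meets \<open>k\<close> and stays inside \<open>S\<close>.\<close>

lemma component_insert_unreachable:
  assumes "i \<in> S" "\<not> reachable (induced G (insert k S)) i k"
  shows "component (induced G (insert k S)) i = component (induced G S) i"
proof -
  have "reachable (induced G S) i u" if "reachable (induced G (insert k S)) i u" for u
    using that unfolding reachable_def
  proof (induction rule: rtranclp_induct)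
    case (step u v)
    then have "reachable (induced G (insert k S)) i u" and "reachable (induced G (insert k S)) i v"
      unfolding reachable_def by (auto intro: rtranclp.rtrancl_into_rtrancl)
    with assms(2) have "u \<noteq> k" "v \<noteq> k" by auto
    then have "{u, v} \<in> edges (induced G S)" using step.hyps(2) by (simp add: edges_induced)
    with step.IH show ?case by (rule rtranclp.rtrancl_into_rtrancl)
  qed simp
  then have "reachable (induced G (insert k S)) i u \<longleftrightarrow> reachable (induced G S) i u" for u
    using reachable_induced_mono by blast
  moreover have "verts (induced G (insert k S)) \<subseteq> insert k (verts (induced G S))"
    "verts (induced G S) \<subseteq> verts (induced G (insert k S))"
    by (auto simp: induced_def)
  ultimately show ?thesis using assms(2) by (auto simp: component_def)
qed

text \<open>If \<open>i\<close> and \<open>k\<close> are connected, the tube \<open>?X\<close>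
  created by \<open>i\<close> before \<open>k\<close> arrives is lost after the swap: it contains
  \<open>i\<close>, which rules out the tubes of \<open>A\<close> and the tube of \<open>k\<close>;
  it misses \<open>k\<close>, which rules out the new tube of \<open>i\<close>; and it is disjoint
  from \<open>B\<close>, whose tubes each meet \<open>B\<close>. If they are not connected, neither
  component notices the other vertex.\<close>

lemma Psi_adjacent_swap:
  assumes "distinct (A @ i # k # B)" "set (A @ i # k # B) \<subseteq> verts G"
  shows "Psi G (A @ i # k # B) = Psi G (A @ k # i # B) \<longleftrightarrow>
    \<not> reachable (induced G (insert i (insert k (set A)))) i k"
proof -
  let ?S = "set A"
  let ?H = "induced G (insert i (insert k ?S))"
  have x: "Psi G (A @ i # k # B) = tubes G {} A \<union> {component (induced G (insert i ?S)) i, component ?H k}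
      \<union> tubes G (insert i (insert k ?S)) B"
    by (auto simp: Psi_eq_tubes tubes_append insert_commute)
  have y: "Psi G (A @ k # i # B) = tubes G {} A \<union> {component (induced G (insert k ?S)) k, component ?H i}
      \<union> tubes G (insert i (insert k ?S)) B"
    by (auto simp: Psi_eq_tubes tubes_append insert_commute)
  show ?thesis
  proof (cases "reachable ?H i k")
    case True
    let ?X = "component (induced G (insert i ?S)) i"
    have iX: "i \<in> ?X" using assms(2) by (auto simp: component_def induced_def)
    have sub: "?X \<subseteq> insert i ?S" by (rule component_subset)
    have "?X \<notin> tubes G {} A" using iX tubes_subset[of ?X G "{}" A] assms(1) by auto
    moreover have "?X \<noteq> component (induced G (insert k ?S)) k"
      using iX component_subset[of G "insert k ?S" k] assms(1) by auto
    moreover have "k \<in> component ?H i" using True assms(2) by (auto simp: component_def induced_def)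
    then have "?X \<noteq> component ?H i" using sub assms(1) by auto
    moreover have "?X \<notin> tubes G (insert i (insert k ?S)) B"
      using tubes_meet[of ?X G "insert i (insert k ?S)" B] sub assms by auto
    ultimately have "?X \<notin> Psi G (A @ k # i # B)" unfolding y by blast
    moreover have "?X \<in> Psi G (A @ i # k # B)" unfolding x by blast
    ultimately show ?thesis using True by auto
  next
    case False
    then have "\<not> reachable ?H k i" using reachable_sym by blast
    then have "component ?H k = component (induced G (insert k ?S)) k"
      by (intro component_insert_unreachable) auto
    moreover have "component ?H i = component (induced G (insert i ?S)) i"
      using False component_insert_unreachable[of i "insert i ?S" G k] by (simp add: insert_commute)
    ultimately show ?thesis using False unfolding x y by auto
  qed
qed

text \<open>The criterion is established for every cover with the given arc, so the existential in
  \<open>contracts\<close> does not depend on the cover chosen; \<open>cover_arc_exists\<close>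
  ensures that there is one.\<close>

lemma contracts_iff_not_linked:
  assumes "filled G" "verts G = {1..n}" "(i, k, \<epsilon>) \<in> arcs n"
  shows "contracts n (fiber_congruence n G) (i, k, \<epsilon>) \<longleftrightarrow> \<not> linked G (minus_set (i, k, \<epsilon>)) i k"
proof -
  have "(x, y) \<in> fiber_congruence n G \<longleftrightarrow> \<not> linked G (minus_set (i, k, \<epsilon>)) i k"
    if cover: "cover_arc n x y (i, k, \<epsilon>)" for x y
  proof -
    from cover obtain A B where AB: "x = A @ i # k # B" "y = A @ k # i # B" "x \<in> perms n"
      "set A \<inter> {i<..<k} = minus_set (i, k, \<epsilon>)" by (rule cover_arcE)
    have "i < k" using assms(3) by (simp add: arcs_def)
    have x: "distinct x" "set x = {1..n}" using AB(3) by (auto simp: permutations_of_set_def)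
    then have "y \<in> perms n" using AB by (auto simp: permutations_of_set_def)
    then have "(x, y) \<in> fiber_congruence n G \<longleftrightarrow> Psi G x = Psi G y"
      using AB(3) by (simp add: fiber_congruence_def)
    also have "\<dots> \<longleftrightarrow> \<not> reachable (induced G (insert i (insert k (set A)))) i k"
      unfolding AB(1,2) using x assms(2) AB(1) by (intro Psi_adjacent_swap) auto
    also have "\<dots> \<longleftrightarrow> \<not> linked G (set A) i k"
      using reachable_iff_linked[OF assms(1) \<open>i < k\<close>] by simp
    also have "\<dots> \<longleftrightarrow> \<not> linked G (minus_set (i, k, \<epsilon>)) i k"
      using linked_cong[of "set A" i k "minus_set (i, k, \<epsilon>)" G] AB(4)
      by (auto simp: minus_set_def)
    finally show ?thesis .
  qed
  moreover obtain x y where "cover_arc n x y (i, k, \<epsilon>)"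
    using cover_arc_exists[OF assms(3)] by blast
  ultimately show ?thesis unfolding contracts_def by blast
qed

section \<open>Families of filled graphs\<close>

definition skip :: "nat \<Rightarrow> nat \<Rightarrow> nat" where
  "skip k v = (if v < k then v else Suc v)"

definition unskip :: "nat \<Rightarrow> nat \<Rightarrow> nat" where
  "unskip k v = (if v < k then v else v - 1)"

lemma unskip_skip [simp]: "unskip k (skip k v) = v"
  by (simp add: skip_def unskip_def)

lemma skip_unskip [simp]: "v \<noteq> k \<Longrightarrow> skip k (unskip k v) = v"
  by (auto simp: skip_def unskip_def)

lemma skip_neq [simp]: "skip k v \<noteq> k"
  by (simp add: skip_def)

lemma skip_le_iff [simp]: "skip k u \<le> skip k v \<longleftrightarrow> u \<le> v"
  by (auto simp: skip_def)

lemma skip_less_iff [simp]: "skip k u < skip k v \<longleftrightarrow> u < v"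
  by (auto simp: skip_def)

lemma inj_skip: "inj (skip k)"
  by (metis injI unskip_skip)

lemma range_skip: "range (skip k) = - {k}"
proof -
  have "v \<in> range (skip k)" if "v \<noteq> k" for v
    using skip_unskip[OF that] by (metis rangeI)
  then show ?thesis by auto
qed

text \<open>Ranks are invariant under increasing relabelling, so standardizing after the removal of
  a set can be carried out one vertex at a time.\<close>

lemma rank_image_skip: "rank (skip k ` V) (skip k v) = rank V v"
proof -
  have "{u \<in> skip k ` V. u \<le> skip k v} = skip k ` {u \<in> V. u \<le> v}" by auto
  then show ?thesis
    unfolding rank_def by (simp add: card_image[OF inj_on_subset[OF inj_skip]])
qed

lemma rank_atLeast1AtMost: "v \<le> n \<Longrightarrow> rank {1..n} v = v"
proof -
  assume "v \<le> n"
  then have "{u \<in> {1..n}. u \<le> v} = {1..v}" by auto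
  then show ?thesis by (simp add: rank_def)
qed

lemma interval_minus_eq_skip_image:
  assumes "k \<in> {1..Suc n}" "k \<in> I"
  shows "{1..Suc n} - I = skip k ` ({1..n} - skip k -` I)"
proof -
  have "v \<in> skip k ` ({1..n} - skip k -` I)" if "v \<in> {1..Suc n} - I" for v
  proof (rule image_eqI)
    have "v \<noteq> k" using that assms by auto
    then show "v = skip k (unskip k v)" by simp
    have "unskip k v \<in> {1..n}" using that assms(1) \<open>v \<noteq> k\<close> by (auto simp: unskip_def)
    then show "unskip k v \<in> {1..n} - skip k -` I" using that \<open>v \<noteq> k\<close> by simp
  qed
  moreover have "skip k v \<in> {1..Suc n}" if "v \<in> {1..n}" for v
    using that by (auto simp: skip_def)
  ultimately show ?thesis by blast
qed

lemma rank_minus_singleton: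
  assumes "k \<in> {1..Suc n}" "v \<in> {1..Suc n}" "v \<noteq> k"
  shows "rank ({1..Suc n} - {k}) v = unskip k v"
proof -
  have "skip k -` {k} = {}" by auto
  then have "{1..Suc n} - {k} = skip k ` {1..n}"
    using interval_minus_eq_skip_image[OF assms(1), of "{k}"] by simp
  moreover have "unskip k v \<le> n" using assms by (auto simp: unskip_def)
  ultimately show ?thesis
    using rank_image_skip[of k "{1..n}" "unskip k v"] rank_atLeast1AtMost[of "unskip k v" n] assms(3)
    by simp
qed

section \<open>Contractions of graphs and deletions in arcs\<close>

lemma verts_contraction: "verts (contraction G I) = verts G - I"
  by (simp add: contraction_def)

lemma edges_contraction:
  "edges (contraction G I) = {{i, j} | i j. i \<in> verts G - I \<and> j \<in> verts G - I \<and> i \<noteq> j \<and>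
    ({i, j} \<in> edges G \<or>
     (\<exists>J k l. tube (induced G I) J \<and> k \<in> J \<and> l \<in> J \<and> {i, k} \<in> edges G \<and> {j, l} \<in> edges G))}"
  by (simp add: contraction_def)

text \<open>An edge created by a tube \<open>J\<close> becomes a walk from \<open>i\<close> to
  \<open>k\<close>, through \<open>J\<close> to \<open>l\<close>, and on to \<open>j\<close>. This
  replaces tubes by the connectivity that \<open>linked\<close> describes.\<close>

lemma contraction_edge_reachable:
  assumes "e \<in> edges (contraction G I)"
  obtains i j where "e = {i, j}" "i \<noteq> j" "i \<in> verts G - I" "j \<in> verts G - I"
    "reachable (induced G (insert i (insert j I))) i j"
proof -
  from assms have "\<exists>i j. e = {i, j} \<and> i \<in> verts G - I \<and> j \<in> verts G - I \<and> i \<noteq> j \<and>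
      ({i, j} \<in> edges G \<or> (\<exists>J k l. tube (induced G I) J \<and> k \<in> J \<and> l \<in> J \<and>
        {i, k} \<in> edges G \<and> {j, l} \<in> edges G))"
    unfolding edges_contraction by (rule CollectD)
  then obtain i j where ij: "e = {i, j}" "i \<noteq> j" "i \<in> verts G - I" "j \<in> verts G - I"
    and edge: "{i, j} \<in> edges G \<or> (\<exists>J k l. tube (induced G I) J \<and> k \<in> J \<and> l \<in> J \<and>
      {i, k} \<in> edges G \<and> {j, l} \<in> edges G)"
    by (elim exE conjE)
  let ?H = "induced G (insert i (insert j I))"
  from edge have "reachable ?H i j"
  proof (elim disjE exE conjE)
    assume "{i, j} \<in> edges G"
    then show ?thesis by (intro reachable_edge) (simp add: edges_induced)
  next
    fix J k l
    assume J: "tube (induced G I) J" "k \<in> J" "l \<in> J" and edges: "{i, k} \<in> edges G" "{j, l} \<in> edges G"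
    from J(1) have JI: "J \<subseteq> verts G \<inter> I" and conn: "connected_graph (induced (induced G I) J)"
      by (auto simp: tube_def induced_def)
    then have "reachable (induced (induced G I) J) k l"
      using J(2,3) by (auto simp: connected_graph_def induced_def)
    then have "reachable ?H k l" by (rule reachable_mono) (auto simp: induced_def)
    moreover have "reachable ?H i k" "reachable ?H j l"
      using edges J JI by (auto intro!: reachable_edge simp: edges_induced)
    ultimately show ?thesis by (blast intro: reachable_trans reachable_sym)
  qed
  with ij that show ?thesis by blast
qed

text \<open>Every defined deletion amounts to removing one vertex \<open>c\<close> other than the
  endpoints, even if \<open>k\<close> is an endpoint. Outside the interval \<open>c\<close> is
  \<open>k\<close>; inside, it is the vertex whose sign is dropped.\<close>

lemma arc_delete_skip:
  assumes "(i, j, \<epsilon>) \<in> arcs (Suc n)" "k \<in> {1..Suc n}" "arc_delete (i, j, \<epsilon>) k = Some \<alpha>"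
  obtains c \<epsilon>' where "c \<in> {1..Suc n}" "c \<noteq> i" "c \<noteq> j" "\<alpha> = (unskip c i, unskip c j, \<epsilon>')"
    "minus_set \<alpha> = skip c -` minus_set (i, j, \<epsilon>)"
proof -
  have ij: "1 \<le> i" "i < j" "j \<le> Suc n" "length \<epsilon> = j - i - 1" using assms(1) by (auto simp: arcs_def)
  consider "k < i" | "j < k" | "i \<le> k" "k \<le> j" by linarith
  then show ?thesis
  proof cases
    case 1
    then have \<alpha>: "\<alpha> = (i - 1, j - 1, \<epsilon>)" using assms(3) by simp
    show ?thesis
    proof (rule that[of k \<epsilon>])
      show "minus_set \<alpha> = skip k -` minus_set (i, j, \<epsilon>)"
        using 1 ij by (auto simp: \<alpha> minus_set_def skip_def)
    qed (use 1 ij assms(2) \<alpha> in \<open>auto simp: unskip_def\<close>)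
  next
    case 2
    then have \<alpha>: "\<alpha> = (i, j, \<epsilon>)" using assms(3) ij by simp
    show ?thesis
    proof (rule that[of k \<epsilon>])
      show "minus_set \<alpha> = skip k -` minus_set (i, j, \<epsilon>)"
        using 2 ij by (auto simp: \<alpha> minus_set_def skip_def)
    qed (use 2 ij assms(2) \<alpha> in \<open>auto simp: unskip_def\<close>)
  next
    case 3
    define \<epsilon>' where "\<epsilon>' = map (\<lambda>l. if l \<le> k - i then \<epsilon> ! (l - 1) else \<epsilon> ! l) [1..<j - i - 1]"
    have j: "j \<noteq> i + 1" and \<alpha>: "\<alpha> = (i, j - 1, \<epsilon>')"
      using 3 assms(3) by (auto simp: \<epsilon>'_def split: if_splits)
    \<comment> \<open>With \<open>k\<close> in this range, \<open>arc_delete\<close> drops the sign of the vertex \<open>k + 1\<close>, not of \<open>k\<close>,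
      and the last sign if \<open>k + 1\<close> is too large.\<close>
    define c where "c = min (k + 1) (j - 1)"
    have c: "i < c" "c < j" using 3 ij j by (auto simp: c_def)
    have sign: "\<epsilon>' ! (v - i - 1) = \<epsilon> ! (skip c v - i - 1)" if "i < v" "v < j - 1" for v
    proof -
      \<comment> \<open>Index \<open>v - i - 1\<close> of the list \<open>[1..<j - i - 1]\<close>
        holds \<open>l = v - i\<close>.\<close>
      have "\<epsilon>' ! (v - i - 1) = (if v - i \<le> k - i then \<epsilon> ! (v - i - 1) else \<epsilon> ! (v - i))"
        using that Suc_diff_Suc[of i v] by (simp add: \<epsilon>'_def)
      also have "\<dots> = \<epsilon> ! (skip c v - i - 1)"
        using that 3 by (auto simp: skip_def c_def)
      finally show ?thesis .
    qed
    show ?thesis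
    proof (rule that[of c \<epsilon>'])
      have "v \<in> minus_set \<alpha> \<longleftrightarrow> skip c v \<in> minus_set (i, j, \<epsilon>)" for v
      proof -
        have "v \<in> {i<..<j - 1} \<longleftrightarrow> skip c v \<in> {i<..<j}"
          using c by (auto simp: skip_def)
        then show ?thesis using sign[of v] unfolding \<alpha> minus_set_def by auto
      qed
      then show "minus_set \<alpha> = skip c -` minus_set (i, j, \<epsilon>)" by auto
    qed (use c ij \<alpha> in \<open>auto simp: unskip_def\<close>)
  qed
qed

section \<open>Sequences of filled graphs\<close>

locale filled_graph_family =
  fixes \<G> :: "nat \<Rightarrow> graph"
  assumes simple: "\<And>n. simple_graph (\<G> n)"
    and verts [simp]: "\<And>n. verts (\<G> n) = {1..n}"
    and filled: "\<And>n. filled (\<G> n)"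
begin

lemma edgeE:
  assumes "e \<in> edges (\<G> n)"
  obtains a b where "e = {a, b}" "1 \<le> a" "a < b" "b \<le> n"
proof -
  have "\<exists>u v. e = {u, v} \<and> u \<in> {1..n} \<and> v \<in> {1..n} \<and> u \<noteq> v"
    using assms simple[of n] by (auto simp: simple_graph_def)
  then obtain u v where "e = {u, v}" "u \<in> {1..n}" "v \<in> {1..n}" "u \<noteq> v" by blast
  then show ?thesis
    using that[of u v] that[of v u] by (cases "u < v") (auto simp: insert_commute)
qed

lemma contracts_iff:
  "(i, k, \<epsilon>) \<in> arcs n \<Longrightarrow>
    contracts n (fiber_congruence n (\<G> n)) (i, k, \<epsilon>) \<longleftrightarrow> \<not> linked (\<G> n) (minus_set (i, k, \<epsilon>)) i k"
  by (rule contracts_iff_not_linked) (simp_all add: filled)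

section \<open>First equivalence: shifting edges\<close>

definition translation_invariant :: bool where
  "translation_invariant \<longleftrightarrow> (\<forall>n m a b c d.
     1 \<le> a \<and> a < b \<and> b \<le> n \<and> 1 \<le> c \<and> c < d \<and> d \<le> m \<and> b - a = d - c \<and>
     {a, b} \<in> edges (\<G> n) \<longrightarrow> {c, d} \<in> edges (\<G> m))"

lemma translation_invariantD:
  "translation_invariant \<Longrightarrow> {a, b} \<in> edges (\<G> n) \<Longrightarrow> 1 \<le> a \<Longrightarrow> a < b \<Longrightarrow> b \<le> n \<Longrightarrow>
    1 \<le> c \<Longrightarrow> c < d \<Longrightarrow> d \<le> m \<Longrightarrow> b - a = d - c \<Longrightarrow> {c, d} \<in> edges (\<G> m)"
  unfolding translation_invariant_def by blast

text \<open>Restricting to the initial interval \<open>{1..b}\<close> replaces \<open>n\<close> by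
  \<open>b\<close>; restricting further to the final interval \<open>{a..b}\<close> gives a shifted
  copy of a smaller graph. Edges of equal length thus have the same normal form.\<close>

lemma admissible_edge_iff:
  assumes "admissible \<G>" "1 \<le> a" "a < b" "b \<le> n"
  shows "{a, b} \<in> edges (\<G> n) \<longleftrightarrow> {1, b - a + 1} \<in> edges (\<G> (b - a + 1))"
proof -
  let ?s = "a - 1" and ?t = "b - a + 1"
  have "induced (\<G> (b + (n - b))) {1..b} = \<G> b"
    using assms(1) unfolding admissible_def by blast
  then have "{a, b} \<in> edges (\<G> b) \<longleftrightarrow> {a, b} \<in> edges (induced (\<G> n) {1..b})"
    using assms(4) by simp
  then have "{a, b} \<in> edges (\<G> n) \<longleftrightarrow> {a, b} \<in> edges (\<G> b)"
    using assms by (simp add: edges_induced)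
  also have "\<dots> \<longleftrightarrow> {a, b} \<in> edges (induced (\<G> (?s + ?t)) {?s + 1..?s + ?t})"
    using assms by (simp add: edges_induced)
  also have "induced (\<G> (?s + ?t)) {?s + 1..?s + ?t} = relabel (\<lambda>v. v + ?s) (\<G> ?t)"
    using assms(1) unfolding admissible_def by blast
  also have "{a, b} \<in> edges (relabel (\<lambda>v. v + ?s) (\<G> ?t)) \<longleftrightarrow> {1, ?t} \<in> edges (\<G> ?t)"
  proof -
    have "{a, b} = (\<lambda>v. v + ?s) ` {1, ?t}" using assms by auto
    moreover have "inj (\<lambda>e. (\<lambda>v. v + ?s) ` e)" by (intro injI) (simp add: inj_image_eq_iff)
    ultimately show ?thesis by (simp only: relabel_def graph.simps inj_image_mem_iff)
  qed
  finally show ?thesis .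
qed

lemma admissible_iff: "admissible \<G> \<longleftrightarrow> translation_invariant"
proof
  assume "admissible \<G>"
  then show translation_invariant
    unfolding translation_invariant_def using admissible_edge_iff by metis
next
  assume ti: translation_invariant
  show "admissible \<G>"
    unfolding admissible_def
  proof (intro allI conjI)
    fix n m
    have "{e \<in> edges (\<G> (n + m)). e \<subseteq> {1..n}} = edges (\<G> n)"
    proof (intro set_eqI iffI)
      fix e assume e: "e \<in> {e \<in> edges (\<G> (n + m)). e \<subseteq> {1..n}}"
      then obtain a b where "e = {a, b}" "1 \<le> a" "a < b" by (auto elim: edgeE)
      then show "e \<in> edges (\<G> n)"
        using e translation_invariantD[OF ti, of a b "n + m" a b n] by auto
    next
      fix e assume e: "e \<in> edges (\<G> n)"
      then obtain a b where "e = {a, b}" "1 \<le> a" "a < b" "b \<le> n" by (rule edgeE)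
      then show "e \<in> {e \<in> edges (\<G> (n + m)). e \<subseteq> {1..n}}"
        using e translation_invariantD[OF ti, of a b n a b "n + m"] by auto
    qed
    then show "induced (\<G> (n + m)) {1..n} = \<G> n"
      by (auto simp: induced_def intro!: graph.equality)
    have "{e \<in> edges (\<G> (n + m)). e \<subseteq> {n + 1..n + m}} = (\<lambda>e. (\<lambda>v. v + n) ` e) ` edges (\<G> m)"
    proof (intro set_eqI iffI)
      fix e assume e: "e \<in> {e \<in> edges (\<G> (n + m)). e \<subseteq> {n + 1..n + m}}"
      then obtain a b where ab: "e = {a, b}" "1 \<le> a" "a < b" by (auto elim: edgeE)
      show "e \<in> (\<lambda>e. (\<lambda>v. v + n) ` e) ` edges (\<G> m)"
      proof (rule image_eqI)
        show "{a - n, b - n} \<in> edges (\<G> m)"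
          by (rule translation_invariantD[OF ti, of a b "n + m"]) (use e ab in auto)
        show "e = (\<lambda>v. v + n) ` {a - n, b - n}" using e ab by auto
      qed
    next
      fix e assume "e \<in> (\<lambda>e. (\<lambda>v. v + n) ` e) ` edges (\<G> m)"
      then obtain e' where e': "e' \<in> edges (\<G> m)" "e = (\<lambda>v. v + n) ` e'" by blast
      then obtain a b where ab: "e' = {a, b}" "1 \<le> a" "a < b" "b \<le> m" by (auto elim: edgeE)
      have "{a + n, b + n} \<in> edges (\<G> (n + m))"
        by (rule translation_invariantD[OF ti, of a b m]) (use e' ab in auto)
      then show "e \<in> {e \<in> edges (\<G> (n + m)). e \<subseteq> {n + 1..n + m}}"
        using e' ab by auto
    qed
    moreover have "{1..n + m} \<inter> {n + 1..n + m} = (\<lambda>v. v + n) ` {1..m}"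
      by (auto simp: image_add_atLeastAtMost')
    ultimately show "induced (\<G> (n + m)) {n + 1..n + m} = relabel (\<lambda>v. v + n) (\<G> m)"
      by (auto simp: induced_def relabel_def intro!: graph.equality)
  qed
qed

text \<open>An all-plus arc is not contracted exactly if its endpoints are adjacent, which gives one
  direction. Conversely, a contracted arc has a nonadjacent pair with only plus signs strictly
  between, and translation invariance moves that pair along with the arc.\<close>

lemma translational_iff:
  "translational (\<lambda>n. fiber_congruence n (\<G> n)) \<longleftrightarrow> translation_invariant"
proof
  assume tr: "translational (\<lambda>n. fiber_congruence n (\<G> n))"
  show translation_invariant
    unfolding translation_invariant_def
  proof (intro allI impI)
    fix n m a b c d
    assume *: "1 \<le> a \<and> a < b \<and> b \<le> n \<and> 1 \<le> c \<and> c < d \<and> d \<le> m \<and> b - a = d - c \<and>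
      {a, b} \<in> edges (\<G> n)"
    define \<epsilon> where "\<epsilon> = replicate (b - a - 1) Plus"
    have arcs: "(a, b, \<epsilon>) \<in> arcs n" "(c, d, \<epsilon>) \<in> arcs m"
      using * by (auto simp: arcs_def \<epsilon>_def)
    have "\<not> contracts n (fiber_congruence n (\<G> n)) (a, b, \<epsilon>)"
      using * arcs linked_if_edge[OF filled] by (simp add: contracts_iff)
    \<comment> \<open>Being translates is symmetric, so translationality is applied from
      \<open>m\<close> to \<open>n\<close> and contraposed.\<close>
    then have "\<not> contracts m (fiber_congruence m (\<G> m)) (c, d, \<epsilon>)"
      using tr arcs * unfolding translational_def translate_def by fastforce
    then have "linked (\<G> m) (minus_set (c, d, \<epsilon>)) c d"
      using arcs by (simp add: contracts_iff)
    moreover have "minus_set (c, d, \<epsilon>) = {}"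
      using * by (auto simp: minus_set_def \<epsilon>_def)
    ultimately show "{c, d} \<in> edges (\<G> m)"
      using * by (auto intro: linkedD)
  qed
next
  assume ti: translation_invariant
  show "translational (\<lambda>n. fiber_congruence n (\<G> n))"
    unfolding translational_def
  proof (intro allI ballI impI)
    fix n m \<alpha> \<beta>
    assume arcs: "\<alpha> \<in> arcs n" "\<beta> \<in> arcs m"
      and "contracts n (fiber_congruence n (\<G> n)) \<alpha> \<and> translate \<beta> \<alpha>"
    moreover obtain i j \<epsilon> k l \<epsilon>' where \<alpha>\<beta>: "\<beta> = (i, j, \<epsilon>)" "\<alpha> = (k, l, \<epsilon>')"
      by (metis prod_cases3)
    ultimately have "\<not> linked (\<G> n) (minus_set (k, l, \<epsilon>)) k l" and tr: "j - i = l - k" "\<epsilon>' = \<epsilon>"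
      by (auto simp: contracts_iff translate_def)
    then obtain u v where uv: "k \<le> u" "u < v" "v \<le> l" "{u<..<v} \<inter> minus_set (k, l, \<epsilon>) = {}"
      "{u, v} \<notin> edges (\<G> n)"
      unfolding linked_def by blast
    have ij: "1 \<le> i" "i < j" "j \<le> m" "1 \<le> k" "k < l" "l \<le> n"
      using arcs \<alpha>\<beta> by (auto simp: arcs_def)
    have "\<not> linked (\<G> m) (minus_set (i, j, \<epsilon>)) i j"
    proof
      assume linked: "linked (\<G> m) (minus_set (i, j, \<epsilon>)) i j"
      \<comment> \<open>The pair is shifted by \<open>i - k\<close>, written so that no truncated
        subtraction occurs.\<close>
      have "{u - k + i, v - k + i} \<in> edges (\<G> m)"
      proof (rule linkedD[OF linked])
        have False if w: "w \<in> {u - k + i<..<v - k + i}" "w \<in> minus_set (i, j, \<epsilon>)" for w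
        proof -
          have "w - i + k \<in> {u<..<v} \<inter> minus_set (k, l, \<epsilon>)"
            using w uv(1-3) tr(1) ij by (auto simp: minus_set_def)
          with uv(4) show False by blast
        qed
        then show "{u - k + i<..<v - k + i} \<inter> minus_set (i, j, \<epsilon>) = {}" by blast
      qed (use uv ij tr in auto)
      then have "{u, v} \<in> edges (\<G> n)"
        by (rule translation_invariantD[OF ti]) (use uv ij tr in auto)
      with uv(5) show False ..
    qed
    then show "contracts m (fiber_congruence m (\<G> m)) \<beta>"
      using arcs \<alpha>\<beta> by (simp add: contracts_iff)
  qed
qed

section \<open>Second equivalence: contracting one vertex\<close>

definition contraction_closed :: bool where
  "contraction_closed \<longleftrightarrow> (\<forall>n k a b.
     k \<in> {1..Suc n} \<and> 1 \<le> a \<and> a < b \<and> b \<le> Suc n \<and> k \<noteq> a \<and> k \<noteq> b \<and>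
     linked (\<G> (Suc n)) {k} a b \<longrightarrow> {unskip k a, unskip k b} \<in> edges (\<G> n))"

text \<open>An unseparated pair in the smaller graph is lifted by \<open>skip k\<close>. Between the
  lifted vertices only \<open>k\<close> itself can belong to \<open>I\<close>, so the lifted pair is
  linked relative to \<open>{k}\<close> and \<open>contraction_closed\<close> returns the edge. The
  vertex \<open>k\<close> may or may not lie in \<open>I\<close>; the application to arcs relies on
  this, since the deleted sign can be a plus.\<close>

lemma linked_unskip:
  assumes "contraction_closed" "k \<in> {1..Suc n}" "1 \<le> a" "a < b" "b \<le> Suc n" "k \<noteq> a" "k \<noteq> b"
    and linked: "linked (\<G> (Suc n)) I a b"
  shows "linked (\<G> n) (skip k -` I) (unskip k a) (unskip k b)"
  unfolding linked_def
proof (intro allI impI)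
  fix u v assume uv: "unskip k a \<le> u \<and> u < v \<and> v \<le> unskip k b \<and> {u<..<v} \<inter> skip k -` I = {}"
  then have "skip k (unskip k a) \<le> skip k u" "skip k v \<le> skip k (unskip k b)" by (simp_all only: skip_le_iff)
  then have bounds: "a \<le> skip k u" "skip k v \<le> b" using assms(6,7) by simp_all
  have "linked (\<G> (Suc n)) {k} (skip k u) (skip k v)"
    unfolding linked_def
  proof (intro allI impI)
    fix s t assume st: "skip k u \<le> s \<and> s < t \<and> t \<le> skip k v \<and> {s<..<t} \<inter> {k} = {}"
    have "w \<notin> I" if w: "w \<in> {s<..<t}" for w
    proof -
      have "w \<noteq> k" using w st by blast
      then have wk: "skip k (unskip k w) = w" by simp
      then have "skip k u < skip k (unskip k w)" "skip k (unskip k w) < skip k v"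
        using w st by auto
      then have "unskip k w \<in> {u<..<v}" by simp
      with uv wk show ?thesis by auto
    qed
    then show "{s, t} \<in> edges (\<G> (Suc n))"
      using st bounds by (intro linkedD[OF linked]) auto
  qed
  moreover have "skip k u < skip k v" using uv by simp
  ultimately have "{unskip k (skip k u), unskip k (skip k v)} \<in> edges (\<G> n)"
    using assms(1,2,3,5) bounds skip_neq[of k] unfolding contraction_closed_def
    by (metis le_trans)
  then show "{u, v} \<in> edges (\<G> n)" by simp
qed

text \<open>Induction on the size of \<open>I\<close>: \<open>linked_unskip\<close> removes one
  vertex of \<open>I\<close> and keeps the pair linked relative to the rest, while the ranks stay
  the same. Once \<open>I\<close> is empty, being linked means being adjacent.\<close>

lemma rank_edge_if_linked:
  assumes closed: "contraction_closed"
    and "I \<subseteq> {1..n}" "a \<in> {1..n} - I" "b \<in> {1..n} - I" "a < b" "linked (\<G> n) I a b"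
  shows "{rank ({1..n} - I) a, rank ({1..n} - I) b} \<in> edges (\<G> (n - card I))"
  using assms(2-)
proof (induction "card I" arbitrary: n I a b)
  case 0
  then have "I = {}" using finite_subset[OF 0(2)] by simp
  moreover from this have "{a, b} \<in> edges (\<G> n)" using 0 by (auto intro: linkedD)
  ultimately show ?case using 0 rank_atLeast1AtMost[of a n] rank_atLeast1AtMost[of b n] by simp
next
  case (Suc c)
  then have "I \<noteq> {}" by auto
  then obtain k where k: "k \<in> I" by blast
  with Suc.prems(1) obtain m where n: "n = Suc m" by (cases n) auto
  have k': "k \<in> {1..Suc m}" using k Suc.prems(1) n by auto
  let ?I = "skip k -` I"
  \<comment> \<open>The preimage \<open>?I\<close> is \<open>I\<close> without \<open>k\<close>,
    relabelled to close the gap.\<close>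
  have I: "I = insert k (skip k ` ?I)" using k by (auto simp: image_vimage_eq range_skip)
  have "v \<in> {1..m}" if "v \<in> ?I" for v
  proof -
    have "skip k v \<in> {1..Suc m}" using that Suc.prems(1) n by blast
    then show ?thesis using k' by (auto simp: skip_def split: if_splits)
  qed
  then have sub: "?I \<subseteq> {1..m}" by blast
  have "card I = card (insert k (skip k ` ?I))" using I by (rule arg_cong)
  also have "\<dots> = Suc (card (skip k ` ?I))"
  proof (rule card_insert_disjoint)
    show "finite (skip k ` ?I)" using finite_subset[OF sub] by blast
    show "k \<notin> skip k ` ?I" using skip_neq[of k] by (metis imageE)
  qed
  also have "card (skip k ` ?I) = card ?I"
    by (rule card_image) (rule inj_on_subset[OF inj_skip subset_UNIV])
  finally have card: "card I = Suc (card ?I)" .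
  have V: "{1..n} - I = skip k ` ({1..m} - ?I)"
    unfolding n using interval_minus_eq_skip_image[OF k' k] .
  obtain a' b' where ab: "a = skip k a'" "a' \<in> {1..m} - ?I" "b = skip k b'" "b' \<in> {1..m} - ?I"
    using Suc.prems(2,3) unfolding V by blast
  have "linked (\<G> m) ?I (unskip k a) (unskip k b)"
    using Suc.prems k n by (intro linked_unskip[OF closed k']) auto
  then have "{rank ({1..m} - ?I) a', rank ({1..m} - ?I) b'} \<in> edges (\<G> (m - card ?I))"
    using Suc.hyps(2) card sub ab Suc.prems(4) by (intro Suc.hyps(1)) auto
  then show ?case
    unfolding V unfolding ab(1,3) rank_image_skip card n by simp
qed

text \<open>Contractions of single vertices already give \<open>contraction_closed\<close>.
  Conversely, an edge of any contraction yields a walk, hence a linked pair, and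
  \<open>rank_edge_if_linked\<close> applies.\<close>

lemma restriction_compatible_iff: "restriction_compatible \<G> \<longleftrightarrow> contraction_closed"
proof
  assume rc: "restriction_compatible \<G>"
  show contraction_closed
    unfolding contraction_closed_def
  proof (intro allI impI)
    fix n k a b
    assume *: "k \<in> {1..Suc n} \<and> 1 \<le> a \<and> a < b \<and> b \<le> Suc n \<and> k \<noteq> a \<and> k \<noteq> b \<and>
      linked (\<G> (Suc n)) {k} a b"
    let ?G = "\<G> (Suc n)"
    have "subgraph (std (contraction ?G {k})) (\<G> (Suc n - card {k}))"
      using rc * unfolding restriction_compatible_def by (metis empty_subsetI insert_subset)
    then have sub: "edges (std (contraction ?G {k})) \<subseteq> edges (\<G> n)"
      by (simp add: subgraph_def)
    have tube: "tube (induced ?G {k}) {k}"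
      using * by (auto simp: tube_def induced_def connected_graph_def)
    \<comment> \<open>If \<open>k\<close> lies between \<open>a\<close> and \<open>b\<close>, the
      edge of the contraction comes from the one-vertex tube \<open>{k}\<close>.\<close>
    have "{a, b} \<in> edges ?G \<or> {a, k} \<in> edges ?G \<and> {b, k} \<in> edges ?G"
      using * linked_singleton_iff[OF filled, of a b k] by (auto simp: insert_commute split: if_splits)
    then have "{a, b} \<in> edges ?G \<or> (\<exists>J u v. tube (induced ?G {k}) J \<and> u \<in> J \<and> v \<in> J \<and>
        {a, u} \<in> edges ?G \<and> {b, v} \<in> edges ?G)"
      using tube by blast
    moreover have "a \<in> verts ?G - {k}" "b \<in> verts ?G - {k}" "a \<noteq> b" using * by auto
    ultimately have "{a, b} \<in> edges (contraction ?G {k})"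
      unfolding edges_contraction by blast
    then have "rank (verts (contraction ?G {k})) ` {a, b} \<in> edges (std (contraction ?G {k}))"
      unfolding std_def relabel_def graph.simps by (rule imageI)
    then have "{rank ({1..Suc n} - {k}) a, rank ({1..Suc n} - {k}) b} \<in> edges (\<G> n)"
      using sub by (auto simp: contraction_def)
    then show "{unskip k a, unskip k b} \<in> edges (\<G> n)"
      using * rank_minus_singleton[of k n a] rank_minus_singleton[of k n b] by simp
  qed
next
  assume closed: contraction_closed
  have edge: "rank ({1..n} - I) ` e \<in> edges (\<G> (n - card I))"
    if I: "I \<subseteq> {1..n}" and e: "e \<in> edges (contraction (\<G> n) I)" for n I e
  proof -
    obtain i j where ij: "e = {i, j}" "i \<noteq> j" "i \<in> {1..n} - I" "j \<in> {1..n} - I"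
      "reachable (induced (\<G> n) (insert i (insert j I))) i j"
      using e by (rule contraction_edge_reachable) auto
    have "\<exists>a b. e = {a, b} \<and> a < b \<and> a \<in> {1..n} - I \<and> b \<in> {1..n} - I \<and>
      reachable (induced (\<G> n) (insert a (insert b I))) a b"
    proof (cases "i < j")
      case True
      with ij show ?thesis by blast
    next
      case False
      then have "j < i" using ij(2) by simp
      moreover have "reachable (induced (\<G> n) (insert j (insert i I))) j i"
        using reachable_sym[OF ij(5)] by (simp add: insert_commute)
      ultimately show ?thesis using ij by blast
    qed
    then obtain a b where ab: "e = {a, b}" "a < b" "a \<in> {1..n} - I" "b \<in> {1..n} - I"
      "linked (\<G> n) I a b"
      using reachable_imp_linked[OF filled] by blast
    then show ?thesis using rank_edge_if_linked[OF closed I ab(3,4,2,5)] by simp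
  qed
  have rank_image: "rank V ` V = {1..card V}" if "V \<subseteq> {1..n}" for V and n :: nat
    using rank_bij_betw[of V] finite_subset[OF that] by (simp add: bij_betw_def)
  show "restriction_compatible \<G>"
    unfolding restriction_compatible_def
  proof (intro allI impI conjI)
    fix n :: nat and I assume I: "I \<subseteq> {1..n}"
    have cardI: "card ({1..n} - I) = n - card I"
      using I by (simp add: card_Diff_subset finite_subset)
    show "subgraph (std (contraction (\<G> n) I)) (\<G> (n - card I))"
      unfolding subgraph_def std_def relabel_def graph.simps verts_contraction verts
    proof
      show "rank ({1..n} - I) ` ({1..n} - I) \<subseteq> {1..n - card I}"
        unfolding rank_image[OF Diff_subset] cardI by (rule subset_refl)
      show "(`) (rank ({1..n} - I)) ` edges (contraction (\<G> n) I) \<subseteq> edges (\<G> (n - card I))"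
        using edge[OF I] by (rule image_subsetI)
    qed
    \<comment> \<open>Restriction to \<open>I\<close> is treated as contraction of the complement
      \<open>?J\<close>: the remaining vertices are those of \<open>I\<close>, and every edge inside
      \<open>I\<close> survives.\<close>
    let ?J = "{1..n} - I"
    have J: "{1..n} - ?J = I" "n - card ?J = card I" "?J \<subseteq> {1..n}"
      using I cardI card_mono[OF _ I] by auto
    have "e \<in> edges (contraction (\<G> n) ?J)" if "e \<in> edges (\<G> n)" "e \<subseteq> I" for e
    proof -
      from that(1) obtain a b where "e = {a, b}" "a < b" by (rule edgeE)
      moreover from this that(2) I have "a \<in> verts (\<G> n) - ?J" "b \<in> verts (\<G> n) - ?J" "a \<noteq> b" by auto
      ultimately show ?thesis using that(1) unfolding edges_contraction by blast
    qed
    then have "rank I ` e \<in> edges (\<G> (card I))" if "e \<in> edges (\<G> n)" "e \<subseteq> I" for e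
      using edge[OF J(3), of e] that unfolding J(1,2) by simp
    moreover have "{1..n} \<inter> I = I" using I by blast
    ultimately show "subgraph (std (induced (\<G> n) I)) (\<G> (card I))"
      using rank_image[OF I] by (simp add: subgraph_def std_def relabel_def induced_def image_subset_iff)
  qed
qed

text \<open>One direction contraposes \<open>linked_unskip\<close> for the vertex supplied by
  \<open>arc_delete_skip\<close>. For the other, deleting from an arc whose only possible minus sign
  is at \<open>k\<close> produces an all-plus arc, and this detects the required edge.\<close>

lemma insertional_iff:
  "insertional (\<lambda>n. fiber_congruence n (\<G> n)) \<longleftrightarrow> contraction_closed"
proof
  assume closed: contraction_closed
  show "insertional (\<lambda>n. fiber_congruence n (\<G> n))"
    unfolding insertional_def
  proof (intro allI ballI impI)
    fix n \<alpha> \<beta> k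
    assume \<alpha>: "\<alpha> \<in> arcs n" "contracts n (fiber_congruence n (\<G> n)) \<alpha>"
      and \<beta>: "\<beta> \<in> arcs (n + 1)" and k: "k \<in> {1..n + 1}" and del: "arc_delete \<beta> k = Some \<alpha>"
    obtain i j \<epsilon> where ij: "\<beta> = (i, j, \<epsilon>)" by (metis prod_cases3)
    have bounds: "1 \<le> i" "i < j" "j \<le> Suc n" using \<beta> ij by (auto simp: arcs_def)
    obtain c \<epsilon>' where c: "c \<in> {1..Suc n}" "c \<noteq> i" "c \<noteq> j" "\<alpha> = (unskip c i, unskip c j, \<epsilon>')"
      "minus_set \<alpha> = skip c -` minus_set (i, j, \<epsilon>)"
      using arc_delete_skip[of i j \<epsilon> n k \<alpha>] \<beta> k del ij by auto
    have "\<not> linked (\<G> n) (skip c -` minus_set (i, j, \<epsilon>)) (unskip c i) (unskip c j)"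
      using \<alpha> c(4,5) by (simp add: contracts_iff)
    then have "\<not> linked (\<G> (Suc n)) (minus_set (i, j, \<epsilon>)) i j"
      using linked_unskip[OF closed c(1) bounds] c(2,3) by blast
    then show "contracts (n + 1) (fiber_congruence (n + 1) (\<G> (n + 1))) \<beta>"
      using \<beta> ij by (simp add: contracts_iff)
  qed
next
  assume ins: "insertional (\<lambda>n. fiber_congruence n (\<G> n))"
  show contraction_closed
    unfolding contraction_closed_def
  proof (intro allI impI)
    fix n k a b
    assume *: "k \<in> {1..Suc n} \<and> 1 \<le> a \<and> a < b \<and> b \<le> Suc n \<and> k \<noteq> a \<and> k \<noteq> b \<and>
      linked (\<G> (Suc n)) {k} a b"
    define \<epsilon> where "\<epsilon> = map (\<lambda>v. if v = k then Minus else Plus) [Suc a..<b]"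
    have sign: "\<epsilon> ! (v - a - 1) = (if v = k then Minus else Plus)" if "a < v" "v < b" for v
      using that by (simp add: \<epsilon>_def)
    have \<beta>: "(a, b, \<epsilon>) \<in> arcs (n + 1)" using * by (auto simp: arcs_def \<epsilon>_def)
    have minus: "minus_set (a, b, \<epsilon>) = {k} \<inter> {a<..<b}"
      using sign by (auto simp: minus_set_def split: if_splits)
    then have "linked (\<G> (Suc n)) (minus_set (a, b, \<epsilon>)) a b"
      using * linked_cong[of "{k}" a b "minus_set (a, b, \<epsilon>)"] by auto
    then have "\<not> contracts (n + 1) (fiber_congruence (n + 1) (\<G> (n + 1))) (a, b, \<epsilon>)"
      using \<beta> by (simp add: contracts_iff)
    then have nc: "\<not> contracts n (fiber_congruence n (\<G> n)) \<alpha>"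
      if "\<alpha> \<in> arcs n" "arc_delete (a, b, \<epsilon>) c = Some \<alpha>" "c \<in> {1..n + 1}" for \<alpha> c
      using ins \<beta> that unfolding insertional_def by blast
    have "\<exists>\<epsilon>'. \<exists>c \<in> {1..n + 1}. arc_delete (a, b, \<epsilon>) c = Some (unskip k a, unskip k b, \<epsilon>') \<and>
      (unskip k a, unskip k b, \<epsilon>') \<in> arcs n \<and> minus_set (unskip k a, unskip k b, \<epsilon>') = {}"
    proof (cases "a < k \<and> k < b")
      case True
      \<comment> \<open>For an index inside the interval, \<open>arc_delete\<close> drops the sign
        of the next vertex; removing the sign of \<open>k\<close> therefore calls for index
        \<open>k - 1\<close>.\<close>
      define \<epsilon>' where "\<epsilon>' = map (\<lambda>l. if l \<le> k - 1 - a then \<epsilon> ! (l - 1) else \<epsilon> ! l) [1..<b - a - 1]"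
      have "arc_delete (a, b, \<epsilon>) (k - 1) = Some (a, b - 1, \<epsilon>')"
        using True by (auto simp: \<epsilon>'_def)
      moreover have "\<epsilon>' ! (v - a - 1) = Plus" if "v \<in> {a<..<b - 1}" for v
      proof (cases "v < k")
        case True
        with that have "\<epsilon>' ! (v - a - 1) = \<epsilon> ! (v - a - 1)" by (auto simp: \<epsilon>'_def)
        then show ?thesis using sign[of v] that True by auto
      next
        case False
        with that \<open>a < k \<and> k < b\<close> have "\<epsilon>' ! (v - a - 1) = \<epsilon> ! (Suc v - a - 1)"
          using Suc_diff_Suc[of a v] by (auto simp: \<epsilon>'_def)
        then show ?thesis using sign[of "Suc v"] that False by auto
      qed
      then have "minus_set (a, b - 1, \<epsilon>') = {}" by (auto simp: minus_set_def)
      moreover have "(a, b - 1, \<epsilon>') \<in> arcs n" using True * by (auto simp: arcs_def \<epsilon>'_def)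
      moreover have "unskip k a = a" "unskip k b = b - 1" using True by (auto simp: unskip_def)
      moreover have "k - 1 \<in> {1..n + 1}" using True * by auto
      ultimately show ?thesis by (intro exI[of _ \<epsilon>'] bexI[of _ "k - 1"]) simp_all
    next
      case False
      \<comment> \<open>With \<open>k\<close> outside \<open>{a..b}\<close> all signs are plus
        already, and deletion of \<open>k\<close> only shifts the endpoints if necessary.\<close>
      then have "arc_delete (a, b, \<epsilon>) k = Some (unskip k a, unskip k b, \<epsilon>)"
        using * by (auto simp: unskip_def)
      moreover have "(unskip k a, unskip k b, \<epsilon>) \<in> arcs n"
        using False * by (auto simp: unskip_def arcs_def \<epsilon>_def)
      moreover have "\<epsilon> ! p = Plus" if "p < b - a - 1" for p
        using False that by (auto simp: \<epsilon>_def)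
      then have "minus_set (unskip k a, unskip k b, \<epsilon>) = {}"
        using False * by (auto simp: minus_set_def unskip_def)
      moreover have "k \<in> {1..n + 1}" using * by simp
      ultimately show ?thesis by (intro exI[of _ \<epsilon>] bexI[of _ k] conjI)
    qed
    then obtain \<epsilon>' c where \<alpha>: "c \<in> {1..n + 1}" "arc_delete (a, b, \<epsilon>) c = Some (unskip k a, unskip k b, \<epsilon>')"
      "(unskip k a, unskip k b, \<epsilon>') \<in> arcs n" "minus_set (unskip k a, unskip k b, \<epsilon>') = {}"
      by (elim exE bexE conjE)
    have "linked (\<G> n) {} (unskip k a) (unskip k b)"
      using nc[OF \<alpha>(3,2,1)] unfolding contracts_iff[OF \<alpha>(3)] \<alpha>(4) by simp
    moreover have "unskip k a < unskip k b" using * by (auto simp: unskip_def)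
    ultimately show "{unskip k a, unskip k b} \<in> edges (\<G> n)" by (auto intro: linkedD)
  qed
qed

end

theorem theorem1p2:
  fixes \<G> :: "nat \<Rightarrow> graph" and \<Theta> :: "nat \<Rightarrow> (nat list \<times> nat list) set"
  assumes "\<And>n. simple_graph (\<G> n)"
    and "\<And>n. verts (\<G> n) = {1..n}"
    and "\<And>n. filled (\<G> n)"
    and "\<And>n. \<Theta> n = fiber_congruence n (\<G> n)"
  shows "(admissible \<G> \<longleftrightarrow> translational \<Theta>) \<and>
    (restriction_compatible \<G> \<longleftrightarrow> insertional \<Theta>)"
proof -
  interpret filled_graph_family \<G> using assms(1-3) by unfold_locales
  have "\<Theta> = (\<lambda>n. fiber_congruence n (\<G> n))" using assms(4) by auto
  then show ?thesis
    using admissible_iff translational_iff restriction_compatible_iff insertional_iff by simp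
qed

end
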